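(* Let $R$ be a real closed field. For every integer $n\geq 2$, the ring $R_b(R^n)$ of locally bounded rational functions on $R^n$ is non-Noetherian.
   Context: A rational function on $R^n$ is a quotient $f=p/q$ of polynomials in $n$ variables over $R$ with $q\neq 0$; $\mathrm{dom}(f)$ is the largest dense Zariski open subset of $R^n$ on which $f$ is regular (given as a quotient of polynomials with nowhere vanishing denominator, hence $R$-valued). $f$ is locally bounded if every $x\in R^n$ has a neighbourhood $V_x$ in the euclidean topology (induced by the order of $R$) such that $f(V_x\cap\mathrm{dom}(f))$ is a bounded subset of $R$. $R_b(R^n)$ is the set of all locally bounded rational functions on $R^n$, which is a subring of the field of rational functions. *)

theory Defs
  imports
    "HOL-Analysis.Function_Topology"
    "HOL-Algebra.Ring_Divisibility"
    "HOL-Computational_Algebra.Fraction_Field"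
    "HOL-Library.Poly_Mapping"
begin

class real_closed_field = linordered_field +
  assumes nonneg_is_square: "0 \<le> a \<Longrightarrow> \<exists>b. a = b ^ 2"
    and odd_degree_has_root: "odd d \<Longrightarrow> c d \<noteq> 0 \<Longrightarrow> \<exists>x. (\<Sum>k\<le>d. c k * x ^ k) = 0"

text \<open>
  Polynomials in the countably many variables with index in \<^typ>\<open>nat\<close>; a monomial is a finitely
  supported exponent map.  Polynomials in \<open>n\<close> variables are those that only involve the
  variables with index below \<open>n\<close>.
\<close>

type_synonym 'a mpoly = "(nat \<Rightarrow>\<^sub>0 nat) \<Rightarrow>\<^sub>0 'a"

type_synonym 'a ratfun = "'a mpoly fract"

definition polys :: "nat \<Rightarrow> 'a::zero mpoly set" where
  "polys n = {p. \<forall>m \<in> Poly_Mapping.keys p. Poly_Mapping.keys m \<subseteq> {..<n}}"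

definition peval :: "'a::comm_semiring_1 mpoly \<Rightarrow> (nat \<Rightarrow> 'a) \<Rightarrow> 'a" where
  "peval p x = (\<Sum>m \<in> Poly_Mapping.keys p.
     Poly_Mapping.lookup p m * (\<Prod>i \<in> Poly_Mapping.keys m. x i ^ Poly_Mapping.lookup m i))"

definition ratfuns :: "nat \<Rightarrow> 'a::idom ratfun set" where
  "ratfuns n = {Fract p q |p q. p \<in> polys n \<and> q \<in> polys n \<and> q \<noteq> 0}"

definition affine_space :: "nat \<Rightarrow> (nat \<Rightarrow> 'a) set" where
  "affine_space n = (\<Pi>\<^sub>E i \<in> {..<n}. UNIV)"

definition order_top :: "'a::linorder topology" where
  "order_top = topology_generated_by (range lessThan \<union> range greaterThan)"

definition euclidean_top :: "nat \<Rightarrow> (nat \<Rightarrow> 'a::linorder) topology" where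
  "euclidean_top n = product_topology (\<lambda>i. order_top) {..<n}"

definition zariski_open :: "nat \<Rightarrow> (nat \<Rightarrow> 'a::comm_semiring_1) set \<Rightarrow> bool" where
  "zariski_open n U \<longleftrightarrow>
     (\<exists>P \<subseteq> polys n. U = affine_space n - {x. \<forall>p \<in> P. peval p x = 0})"

definition zariski_dense :: "nat \<Rightarrow> (nat \<Rightarrow> 'a::comm_semiring_1) set \<Rightarrow> bool" where
  "zariski_dense n U \<longleftrightarrow> (\<forall>W. zariski_open n W \<and> W \<noteq> {} \<longrightarrow> U \<inter> W \<noteq> {})"

text \<open>The condition \<open>q \<noteq> 0\<close> matters as \<^term>\<open>Fract p 0 = 0\<close>.\<close>

definition regular_on :: "nat \<Rightarrow> 'a::idom ratfun \<Rightarrow> (nat \<Rightarrow> 'a) set \<Rightarrow> bool" where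
  "regular_on n f U \<longleftrightarrow>
     (\<exists>p \<in> polys n. \<exists>q \<in> polys n. q \<noteq> 0 \<and> f = Fract p q \<and> (\<forall>x \<in> U. peval q x \<noteq> 0))"

text \<open>The largest dense Zariski open set on which \<open>f\<close> is regular, obtained as the union of all of them.\<close>

definition ratfun_dom :: "nat \<Rightarrow> 'a::idom ratfun \<Rightarrow> (nat \<Rightarrow> 'a) set" where
  "ratfun_dom n f = \<Union> {U. zariski_open n U \<and> zariski_dense n U \<and> regular_on n f U}"

text \<open>Only meaningful for \<open>x\<close> in \<open>ratfun_dom n f\<close>, where the value does not depend on \<open>p\<close> and \<open>q\<close>.\<close>

definition ratfun_value :: "nat \<Rightarrow> 'a::field ratfun \<Rightarrow> (nat \<Rightarrow> 'a) \<Rightarrow> 'a" where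
  "ratfun_value n f x =
     (THE v. \<exists>p \<in> polys n. \<exists>q \<in> polys n. f = Fract p q \<and> peval q x \<noteq> 0 \<and> v = peval p x / peval q x)"

definition bounded_subset :: "'a::linordered_field set \<Rightarrow> bool" where
  "bounded_subset S \<longleftrightarrow> (\<exists>B. \<forall>y \<in> S. \<bar>y\<bar> \<le> B)"

definition locally_bounded :: "nat \<Rightarrow> 'a::linordered_field ratfun \<Rightarrow> bool" where
  "locally_bounded n f \<longleftrightarrow>
     (\<forall>x \<in> affine_space n. \<exists>V. openin (euclidean_top n) V \<and> x \<in> V \<and>
        bounded_subset (ratfun_value n f ` (V \<inter> ratfun_dom n f)))"

definition Rb :: "nat \<Rightarrow> 'a::linordered_field ratfun ring" where
  "Rb n = \<lparr>carrier = {f \<in> ratfuns n. locally_bounded n f},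
           mult = (*), one = 1, zero = 0, add = (+)\<rparr>"

end

theory Submission
  imports Defs "HOL-Computational_Algebra.Polynomial"
begin

text \<open>
  Write a rational function as \<open>f = p / q\<close>.  It is locally bounded exactly when every point has a
  neighbourhood \<open>V\<close> and a constant \<open>B\<close> with \<open>\<bar>p\<bar> \<le> B * \<bar>q\<bar>\<close> on all of \<open>V\<close>
  (lemma \<open>locally_bounded_Fract\<close>).  This inequality between polynomials mentions neither the
  domain nor the values of \<open>f\<close>, and it survives the usual formulas for sums and products of fractions,
  so the ring axioms follow.  The equivalence rests on density: an inequality between polynomials that
  holds on an open set away from the zeros of a nonzero polynomial \<open>s\<close> holds on the whole open set.
  To see this, join the point in question to a point where \<open>s\<close> does not vanish; on the line
  everything is a univariate polynomial, so there are only finitely many zeros of \<open>s\<close>, and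
  strict inequalities persist near the starting point.

  For the failure of the Noetherian property write \<open>x\<close> and \<open>y\<close> for the first two coordinates.
  The functions \<open>f\<^sub>k = y\<^sup>2 / (x\<^bsup>2k\<^esup> + y\<^sup>2)\<close> take values in the
  unit interval.  Near the origin \<open>f\<^sub>k\<close> measures how \<open>y\<close> compares with
  \<open>x\<^bsup>k\<^esup>\<close>: it tends to \<open>0\<close> on the thin region
  \<open>\<bar>y\<bar> \<le> \<bar>x\<bar>\<^bsup>k+1\<^esup>\<close>, but on the larger region
  \<open>\<bar>y\<bar> \<le> \<bar>x\<bar>\<^bsup>k\<^esup>\<close> it does not, since there it stays away from
  \<open>0\<close> as long as \<open>\<bar>y\<bar>\<close> is comparable to \<open>\<bar>x\<bar>\<^bsup>k\<^esup>\<close>.  The locally bounded functions that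
  tend to \<open>0\<close> at the origin along a fixed region form an ideal, and the ideal grows as the region
  shrinks.  Hence \<open>f\<^sub>1, f\<^sub>2, \<dots>\<close> show that the ideals of the regions with
  \<open>k = 1, 2, \<dots>\<close> form an infinite strictly ascending chain (lemmas \<open>cusp_fun_vanishes\<close>
  and \<open>cusp_fun_does_not_vanish\<close>).
\<close>

section \<open>Evaluating polynomials\<close>

definition monom_eval :: "(nat \<Rightarrow>\<^sub>0 nat) \<Rightarrow> (nat \<Rightarrow> 'a::comm_semiring_1) \<Rightarrow> 'a" where
  "monom_eval m x = (\<Prod>i\<in>Poly_Mapping.keys m. x i ^ Poly_Mapping.lookup m i)"

lemma monom_eval_superset:
  assumes "finite S" "Poly_Mapping.keys m \<subseteq> S"
  shows "monom_eval m x = (\<Prod>i\<in>S. x i ^ Poly_Mapping.lookup m i)"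
  unfolding monom_eval_def
  by (rule prod.mono_neutral_left) (use assms in \<open>auto simp: in_keys_iff\<close>)

lemma monom_eval_add: "monom_eval (m + m') x = monom_eval m x * monom_eval m' x"
proof -
  let ?S = "Poly_Mapping.keys m \<union> Poly_Mapping.keys m'"
  have "monom_eval k x = (\<Prod>i\<in>?S. x i ^ Poly_Mapping.lookup k i)" if "k \<in> {m, m', m + m'}" for k
    using that keys_add[of m m'] by (intro monom_eval_superset) auto
  then show ?thesis
    by (simp add: lookup_add power_add prod.distrib)
qed

lemma peval_superset:
  assumes "finite S" "Poly_Mapping.keys p \<subseteq> S"
  shows "peval p x = (\<Sum>m\<in>S. Poly_Mapping.lookup p m * monom_eval m x)"
  unfolding peval_def monom_eval_def
  by (rule sum.mono_neutral_left) (use assms in \<open>auto simp: in_keys_iff\<close>)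

lemma peval_0 [simp]: "peval 0 x = 0"
  by (simp add: peval_def)

lemma peval_single: "peval (Poly_Mapping.single m c) x = c * monom_eval m x"
  by (subst peval_superset[of "{m}"]) auto

lemma peval_1 [simp]: "peval 1 x = 1"
  by (simp flip: single_one add: peval_single monom_eval_def)

lemma peval_add: "peval (p + q) x = peval p x + peval q x"
proof -
  let ?S = "Poly_Mapping.keys p \<union> Poly_Mapping.keys q"
  have "peval r x = (\<Sum>m\<in>?S. Poly_Mapping.lookup r m * monom_eval m x)" if "r \<in> {p, q, p + q}" for r
    using that keys_add[of p q] by (intro peval_superset) auto
  then show ?thesis
    by (simp add: lookup_add distrib_right sum.distrib)
qed

lemma peval_sum: "peval (sum f I) x = (\<Sum>i\<in>I. peval (f i) x)"
  by (induction I rule: infinite_finite_induct) (auto simp: peval_add)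

lemma sum_monomials:
  "(\<Sum>m\<in>Poly_Mapping.keys p. Poly_Mapping.single m (Poly_Mapping.lookup p m)) = p"
  by (rule poly_mapping_eqI)
    (auto simp: lookup_sum lookup_single when_def in_keys_iff sum.delta)

lemma peval_mult: "peval (p * q) x = peval p x * peval q x"
proof -
  let ?t = "\<lambda>p m. Poly_Mapping.single m (Poly_Mapping.lookup p m)"
  have "peval (p * q) x = peval ((\<Sum>m\<in>Poly_Mapping.keys p. ?t p m) * (\<Sum>m\<in>Poly_Mapping.keys q. ?t q m)) x"
    by (simp only: sum_monomials)
  also have "\<dots> = (\<Sum>m\<in>Poly_Mapping.keys p. peval (?t p m) x) * (\<Sum>m\<in>Poly_Mapping.keys q. peval (?t q m) x)"
    by (simp add: sum_product peval_sum mult_single peval_single monom_eval_add mult_ac)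
  finally show ?thesis
    by (simp flip: peval_sum add: sum_monomials)
qed

lemma peval_diff: "peval (p - q) x = peval p x - peval q (x :: nat \<Rightarrow> 'a::comm_ring_1)"
  using peval_add[of "p - q" q x] by (simp add: algebra_simps)

lemma peval_uminus: "peval (- p) x = - peval p (x :: nat \<Rightarrow> 'a::comm_ring_1)"
  using peval_diff[of 0 p x] by simp

lemma peval_power: "peval (p ^ k) x = peval p x ^ k"
  by (induction k) (auto simp: peval_mult)

definition var :: "nat \<Rightarrow> 'a::comm_semiring_1 mpoly" where
  "var i = Poly_Mapping.single (Poly_Mapping.single i 1) 1"

lemma peval_var [simp]: "peval (var i) x = x i"
  by (simp add: var_def peval_single monom_eval_def)

lemma polys_var: "i < n \<Longrightarrow> var i \<in> polys n"
  by (auto simp: polys_def var_def split: if_splits)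

lemma polys_0 [simp]: "0 \<in> polys n"
  by (simp add: polys_def)

lemma polys_1 [simp]: "1 \<in> polys n"
  by (simp add: polys_def)

lemma polys_add [intro]: "p \<in> polys n \<Longrightarrow> q \<in> polys n \<Longrightarrow> p + q \<in> polys n"
  using keys_add[of p q] unfolding polys_def by blast

lemma polys_mult [intro]:
  assumes "p \<in> polys n" "q \<in> polys n"
  shows "p * q \<in> polys n"
  unfolding polys_def
proof (intro CollectI ballI)
  fix m assume "m \<in> Poly_Mapping.keys (p * q)"
  then obtain a b where "m = a + b" "a \<in> Poly_Mapping.keys p" "b \<in> Poly_Mapping.keys q"
    using keys_mult[of p q] by blast
  then show "Poly_Mapping.keys m \<subseteq> {..<n}"
    using assms keys_add[of a b] unfolding polys_def by blast
qed

lemma polys_uminus [intro]: "p \<in> polys n \<Longrightarrow> - p \<in> polys n" for p :: "'a::comm_ring_1 mpoly"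
  by (simp add: polys_def in_keys_iff)

lemma polys_power [intro]: "p \<in> polys n \<Longrightarrow> p ^ k \<in> polys n"
  by (induction k) auto

lemma affine_spaceI: "(\<And>i. i \<ge> n \<Longrightarrow> x i = undefined) \<Longrightarrow> x \<in> affine_space n"
  by (auto simp: affine_space_def PiE_def extensional_def)

lemma affine_space_undefined: "x \<in> affine_space n \<Longrightarrow> i \<ge> n \<Longrightarrow> x i = undefined"
  by (auto simp: affine_space_def PiE_def extensional_def)

section \<open>A nonzero polynomial does not vanish identically\<close>

text \<open>
  Uniqueness of base-\<open>N\<close> digits.  It guarantees that the substitution of \<open>t ^ (N ^ i)\<close> for the
  \<open>i\<close>-th variable sends distinct monomials with exponents below \<open>N\<close> to distinct powers of \<open>t\<close>.
\<close>

lemma digits_unique: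
  fixes a b :: "nat \<Rightarrow> nat"
  assumes "\<And>i. i < n \<Longrightarrow> a i < N" "\<And>i. i < n \<Longrightarrow> b i < N"
    and "(\<Sum>i<n. a i * N ^ i) = (\<Sum>i<n. b i * N ^ i)" and "i < n"
  shows "a i = b i"
  using assms
proof (induction n arbitrary: a b i)
  case (Suc n)
  let ?A = "\<Sum>i<n. a (Suc i) * N ^ i" and ?B = "\<Sum>i<n. b (Suc i) * N ^ i"
  have N: "N > 0"
    using Suc.prems(1)[of 0] by simp
  have shift: "(\<Sum>i<Suc n. c i * N ^ i) = c 0 + N * (\<Sum>i<n. c (Suc i) * N ^ i)" for c :: "nat \<Rightarrow> nat"
    by (simp add: sum.lessThan_Suc_shift sum_distrib_left mult_ac del: sum.lessThan_Suc)
  have eq: "a 0 + N * ?A = b 0 + N * ?B"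
    using Suc.prems(3) by (simp only: shift)
  have "a 0 < N" "b 0 < N"
    using Suc.prems by auto
  then have "a 0 = b 0"
    using arg_cong[OF eq, of "\<lambda>k. k mod N"] by simp
  moreover from this eq N have "?A = ?B"
    by simp
  moreover from this have "a (Suc j) = b (Suc j)" if "j < n" for j
    by (rule Suc.IH[rotated 2]) (use Suc.prems that in simp_all)
  ultimately show ?case
    using Suc.prems(4) by (cases i) simp_all
qed simp

lemma finite_exponents_bound:
  fixes p :: "'a::zero mpoly"
  obtains N where "\<And>m i. m \<in> Poly_Mapping.keys p \<Longrightarrow> Poly_Mapping.lookup m i < N"
proof -
  let ?E = "\<Union>m\<in>Poly_Mapping.keys p. Poly_Mapping.lookup m ` Poly_Mapping.keys m"
  have "Poly_Mapping.lookup m i < Suc (Max (insert 0 ?E))" if "m \<in> Poly_Mapping.keys p" for m i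
  proof (cases "i \<in> Poly_Mapping.keys m")
    case True
    then have "Poly_Mapping.lookup m i \<in> insert 0 ?E"
      using that by auto
    then show ?thesis
      using Max_ge[of "insert 0 ?E" "Poly_Mapping.lookup m i"] by (simp add: less_Suc_eq_le)
  qed (simp add: in_keys_iff)
  then show thesis
    by (rule that)
qed

text \<open>
  Kronecker substitution reduces the claim to one variable: replacing the \<open>i\<close>-th variable by
  \<open>t ^ (N ^ i)\<close>, with \<open>N\<close> above all exponents, keeps the coefficients of \<open>p\<close> apart, and a nonzero
  univariate polynomial over an infinite field has a nonroot.
\<close>

lemma polys_nonvanishing_point:
  fixes p :: "'a::field_char_0 mpoly"
  assumes "p \<in> polys n" "p \<noteq> 0"
  obtains x where "x \<in> affine_space n" "peval p x \<noteq> 0"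
proof -
  obtain N where N: "\<And>m i. m \<in> Poly_Mapping.keys p \<Longrightarrow> Poly_Mapping.lookup m i < N"
    using finite_exponents_bound[of p] by blast
  define e where "e m = (\<Sum>i<n. Poly_Mapping.lookup m i * N ^ i)" for m :: "nat \<Rightarrow>\<^sub>0 nat"
  define x where "x t = (\<lambda>i\<in>{..<n}. t ^ (N ^ i))" for t :: 'a
  define P where "P = (\<Sum>m\<in>Poly_Mapping.keys p. monom (Poly_Mapping.lookup p m) (e m))"
  have keys: "Poly_Mapping.keys m \<subseteq> {..<n}" if "m \<in> Poly_Mapping.keys p" for m
    using assms that by (auto simp: polys_def)
  have inj: "m = m'" if m: "m \<in> Poly_Mapping.keys p" "m' \<in> Poly_Mapping.keys p" "e m = e m'" for m m'
  proof (rule poly_mapping_eqI)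
    fix i
    show "Poly_Mapping.lookup m i = Poly_Mapping.lookup m' i"
    proof (cases "i < n")
      case True
      show ?thesis
        by (rule digits_unique[of n _ N])
          (use m N True in \<open>simp_all add: e_def\<close>)
    next
      case False
      then have "i \<notin> Poly_Mapping.keys m" "i \<notin> Poly_Mapping.keys m'"
        using keys m by auto
      then show ?thesis
        by (simp add: in_keys_iff)
    qed
  qed
  have eval: "peval p (x t) = poly P t" for t
  proof -
    have "monom_eval m (x t) = t ^ e m" if "m \<in> Poly_Mapping.keys p" for m
      using monom_eval_superset[OF _ keys[OF that], of "x t"]
      by (simp add: x_def e_def power_sum mult.commute flip: power_mult)
    then show ?thesis
      by (simp add: peval_superset[of "Poly_Mapping.keys p"] P_def poly_sum poly_monom)
  qed
  obtain m0 where m0: "m0 \<in> Poly_Mapping.keys p"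
    using assms(2) by (metis keys_eq_empty ex_in_conv)
  have "coeff P (e m0) = (\<Sum>m\<in>Poly_Mapping.keys p. if m = m0 then Poly_Mapping.lookup p m else 0)"
    unfolding P_def coeff_sum
    by (rule sum.cong) (use inj m0 in auto)
  also have "\<dots> \<noteq> 0"
    using m0 by (simp add: sum.delta in_keys_iff)
  finally have "P \<noteq> 0"
    by auto
  then have "finite {t. poly P t = 0}"
    by (rule poly_roots_finite)
  then obtain t where "poly P t \<noteq> 0"
    using infinite_UNIV_char_0[where 'a = 'a] by (metis (mono_tags, lifting) UNIV_eq_I mem_Collect_eq)
  with eval that[of "x t"] show thesis
    by (auto simp: x_def affine_space_def)
qed

section \<open>Euclidean neighbourhoods and the density of nonvanishing loci\<close>

text \<open>
  The order topology is given by open rays; this is the passage to the \<open>\<delta>\<close>-neighbourhoods used in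
  all estimates.
\<close>

lemma order_top_contains_interval:
  fixes a :: "'a::linordered_field"
  assumes "openin order_top U" "a \<in> U"
  obtains \<delta> where "\<delta> > 0" "\<And>b. \<bar>b - a\<bar> < \<delta> \<Longrightarrow> b \<in> U"
proof -
  have "generate_topology_on (range lessThan \<union> range greaterThan) U"
    using assms(1) by (simp add: order_top_def openin_topology_generated_by_iff)
  then have "\<forall>a\<in>U. \<exists>\<delta>>0. \<forall>b. \<bar>b - a\<bar> < \<delta> \<longrightarrow> b \<in> U"
  proof induction
    case (Int U V)
    show ?case
    proof
      fix a assume "a \<in> U \<inter> V"
      then obtain d e where "d > 0" "\<forall>b. \<bar>b - a\<bar> < d \<longrightarrow> b \<in> U"
        and "e > 0" "\<forall>b. \<bar>b - a\<bar> < e \<longrightarrow> b \<in> V"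
        using Int.IH by blast
      then show "\<exists>\<delta>>0. \<forall>b. \<bar>b - a\<bar> < \<delta> \<longrightarrow> b \<in> U \<inter> V"
        by (intro exI[of _ "min d e"]) auto
    qed
  next
    case (UN K)
    show ?case
    proof
      fix a assume "a \<in> \<Union>K"
      then obtain S where "S \<in> K" "a \<in> S"
        by blast
      with UN.IH[of S] show "\<exists>\<delta>>0. \<forall>b. \<bar>b - a\<bar> < \<delta> \<longrightarrow> b \<in> \<Union>K"
        by blast
    qed
  next
    case (Basis S)
    show ?case
    proof
      fix a assume a: "a \<in> S"
      from Basis obtain c where "S = {..<c} \<or> S = {c<..}"
        by auto
      then show "\<exists>\<delta>>0. \<forall>b. \<bar>b - a\<bar> < \<delta> \<longrightarrow> b \<in> S"
        using a by (intro exI[of _ "\<bar>c - a\<bar>"]) auto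
    qed
  qed simp
  then show thesis
    using assms(2) that by blast
qed

lemma topspace_order_top [simp]: "topspace (order_top :: 'a::linordered_field topology) = UNIV"
proof -
  have "\<Union>(range lessThan \<union> range greaterThan) = (UNIV :: 'a set)"
    using gt_ex by blast
  then show ?thesis
    unfolding order_top_def topology_generated_by_topspace .
qed

lemma topspace_euclidean_top [simp]:
  "topspace (euclidean_top n :: (nat \<Rightarrow> 'a::linordered_field) topology) = affine_space n"
  by (simp add: euclidean_top_def affine_space_def)

lemma openin_euclidean_subset:
  "openin (euclidean_top n) V \<Longrightarrow> V \<subseteq> affine_space n" for V :: "(nat \<Rightarrow> 'a::linordered_field) set"
  using openin_subset by fastforce

lemma euclidean_top_contains_box:
  fixes x :: "nat \<Rightarrow> 'a::linordered_field"
  assumes "openin (euclidean_top n) V" "x \<in> V"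
  obtains \<delta> where "\<delta> > 0"
    "\<And>y. y \<in> affine_space n \<Longrightarrow> (\<And>i. i < n \<Longrightarrow> \<bar>y i - x i\<bar> < \<delta>) \<Longrightarrow> y \<in> V"
proof -
  obtain U where U: "\<And>i. openin order_top (U i)" "x \<in> (\<Pi>\<^sub>E i\<in>{..<n}. U i)" "(\<Pi>\<^sub>E i\<in>{..<n}. U i) \<subseteq> V"
    using product_topology_open_contains_basis[OF assms[unfolded euclidean_top_def]] by metis
  have "\<exists>\<delta>>0. \<forall>b. \<bar>b - x i\<bar> < \<delta> \<longrightarrow> b \<in> U i" if "i < n" for i
    using U that by (auto intro: order_top_contains_interval[of "U i" "x i"])
  then obtain d where d: "\<And>i. i < n \<Longrightarrow> d i > 0" "\<And>i b. i < n \<Longrightarrow> \<bar>b - x i\<bar> < d i \<Longrightarrow> b \<in> U i"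
    by metis
  let ?\<delta> = "Min (insert 1 (d ` {..<n}))"
  show thesis
  proof (rule that)
    show "?\<delta> > 0"
      using d by (subst Min_gr_iff) auto
    fix y :: "nat \<Rightarrow> 'a"
    assume y: "y \<in> affine_space n" "\<And>i. i < n \<Longrightarrow> \<bar>y i - x i\<bar> < ?\<delta>"
    have "y i \<in> U i" if "i < n" for i
    proof -
      have "?\<delta> \<le> d i"
        using that by (intro Min_le) auto
      with y(2)[OF that] have "\<bar>y i - x i\<bar> < d i"
        by (rule less_le_trans)
      then show ?thesis
        by (rule d(2)[OF that])
    qed
    then show "y \<in> V"
      using y(1) U(3) by (auto simp: affine_space_def PiE_def)
  qed
qed

lemma openin_slab:
  fixes a \<delta> :: "'a::linordered_field"
  assumes "i < n"
  shows "openin (euclidean_top n) {x \<in> affine_space n. \<bar>x i - a\<bar> < \<delta>}"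
proof -
  have "openin order_top ({..<a + \<delta>} \<inter> {a - \<delta><..})"
    unfolding order_top_def by (intro openin_Int topology_generated_by_Basis) auto
  moreover have "continuous_map (euclidean_top n) order_top (\<lambda>x :: nat \<Rightarrow> 'a. x i)"
    unfolding euclidean_top_def using assms by (intro continuous_map_product_projection) auto
  ultimately have "openin (euclidean_top n)
      {x \<in> topspace (euclidean_top n). x i \<in> {..<a + \<delta>} \<inter> {a - \<delta><..}}"
    by (intro openin_continuous_map_preimage)
  moreover have "{x \<in> topspace (euclidean_top n). x i \<in> {..<a + \<delta>} \<inter> {a - \<delta><..}}
      = {x \<in> affine_space n. \<bar>x i - a\<bar> < \<delta>}"
    by (auto simp: abs_less_iff algebra_simps)
  ultimately show ?thesis
    by simp
qed

text \<open>
  Outside the first \<open>n\<close> coordinates both endpoints have the same default value, which the formula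
  preserves; so the line lies in the affine space without an explicit restriction.
\<close>

definition line :: "(nat \<Rightarrow> 'a) \<Rightarrow> (nat \<Rightarrow> 'a) \<Rightarrow> 'a \<Rightarrow> nat \<Rightarrow> 'a::comm_ring_1" where
  "line x y t = (\<lambda>i. x i + t * (y i - x i))"

lemma line_0 [simp]: "line x y 0 = x" and line_1 [simp]: "line x y 1 = y"
  by (auto simp: line_def)

lemma line_in_affine_space:
  "x \<in> affine_space n \<Longrightarrow> y \<in> affine_space n \<Longrightarrow> line x y t \<in> affine_space n"
  by (auto intro!: affine_spaceI simp: line_def affine_space_undefined)

lemma peval_line_poly: "\<exists>P. \<forall>t. peval p (line x y t) = poly P t"
proof -
  let ?P = "\<Sum>m\<in>Poly_Mapping.keys p. [:Poly_Mapping.lookup p m:] *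
     (\<Prod>i\<in>Poly_Mapping.keys m. [:x i, y i - x i:] ^ Poly_Mapping.lookup m i)"
  have "peval p (line x y t) = poly ?P t" for t
    by (simp add: peval_def poly_sum poly_prod line_def)
  then show ?thesis
    by blast
qed

lemma poly_bounded_on_unit:
  fixes P :: "'a::linordered_field poly"
  obtains C where "\<And>t. \<bar>t\<bar> \<le> 1 \<Longrightarrow> \<bar>poly P t\<bar> \<le> C"
proof -
  have "\<exists>C. \<forall>t. \<bar>t\<bar> \<le> 1 \<longrightarrow> \<bar>poly P t\<bar> \<le> C"
  proof (induction P)
    case (pCons a P)
    then obtain C where C: "\<And>t. \<bar>t\<bar> \<le> 1 \<Longrightarrow> \<bar>poly P t\<bar> \<le> C"
      by blast
    have "\<bar>poly (pCons a P) t\<bar> \<le> \<bar>a\<bar> + C" if "\<bar>t\<bar> \<le> 1" for t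
    proof -
      have "\<bar>poly (pCons a P) t\<bar> \<le> \<bar>a\<bar> + \<bar>t\<bar> * \<bar>poly P t\<bar>"
        using abs_triangle_ineq[of a "t * poly P t"] by (simp add: abs_mult)
      also have "\<bar>t\<bar> * \<bar>poly P t\<bar> \<le> 1 * C"
        using that C by (intro mult_mono) auto
      finally show ?thesis
        by simp
    qed
    then show ?case
      by blast
  qed auto
  then show thesis
    using that by blast
qed

lemma poly_pos_near_0:
  fixes P :: "'a::linordered_field poly"
  assumes "poly P 0 > 0"
  obtains \<epsilon> where "\<epsilon> > 0" "\<And>t. \<bar>t\<bar> < \<epsilon> \<Longrightarrow> poly P t > 0"
proof -
  obtain a Q where P: "P = pCons a Q"
    by (cases P)
  have a: "a > 0"
    using assms by (simp add: P)
  obtain C where C: "\<And>t. \<bar>t\<bar> \<le> 1 \<Longrightarrow> \<bar>poly Q t\<bar> \<le> C"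
    using poly_bounded_on_unit[of Q] by blast
  have "C \<ge> 0"
    using C[of 0] by simp
  define \<epsilon> where "\<epsilon> = min 1 (a / (C + 1))"
  show thesis
  proof (rule that)
    show "\<epsilon> > 0"
      using a \<open>C \<ge> 0\<close> by (simp add: \<epsilon>_def)
    fix t :: 'a assume t: "\<bar>t\<bar> < \<epsilon>"
    have "\<bar>t * poly Q t\<bar> \<le> \<bar>t\<bar> * (C + 1)"
      unfolding abs_mult using t C[of t] by (intro mult_left_mono) (auto simp: \<epsilon>_def)
    also have "\<dots> < a"
      using t \<open>C \<ge> 0\<close> by (simp add: \<epsilon>_def pos_less_divide_eq)
    finally show "poly P t > 0"
      by (simp add: P abs_less_iff)
  qed
qed

text \<open>
  The speed of the line in each coordinate is at most \<open>M = 1 + (\<Sum>i<n. \<bar>y i - x i\<bar>)\<close>, so for times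
  below \<open>\<delta> / M\<close> the line stays in a box of radius \<open>\<delta>\<close>; the summand \<open>1\<close> only makes \<open>M\<close> positive.
\<close>

lemma line_near_start:
  fixes x y :: "nat \<Rightarrow> 'a::linordered_field"
  assumes "openin (euclidean_top n) V" "x \<in> V" "y \<in> affine_space n"
  obtains \<epsilon> where "\<epsilon> > 0" "\<And>t. \<bar>t\<bar> < \<epsilon> \<Longrightarrow> line x y t \<in> V"
proof -
  obtain \<delta> where \<delta>: "\<delta> > 0"
    "\<And>z. z \<in> affine_space n \<Longrightarrow> (\<And>i. i < n \<Longrightarrow> \<bar>z i - x i\<bar> < \<delta>) \<Longrightarrow> z \<in> V"
    using assms euclidean_top_contains_box by metis
  define M where "M = 1 + (\<Sum>i<n. \<bar>y i - x i\<bar>)"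
  have M: "M > 0"
    unfolding M_def by (intro add_pos_nonneg sum_nonneg) auto
  show thesis
  proof (rule that)
    show "\<delta> / M > 0"
      using \<delta> M by simp
    fix t assume t: "\<bar>t\<bar> < \<delta> / M"
    show "line x y t \<in> V"
    proof (rule \<delta>(2))
      show "line x y t \<in> affine_space n"
        using assms openin_euclidean_subset by (blast intro: line_in_affine_space)
      fix i assume "i < n"
      then have "\<bar>y i - x i\<bar> \<le> (\<Sum>i<n. \<bar>y i - x i\<bar>)"
        by (intro member_le_sum) auto
      then have "\<bar>y i - x i\<bar> \<le> M"
        by (simp add: M_def)
      then have "\<bar>t\<bar> * \<bar>y i - x i\<bar> \<le> \<bar>t\<bar> * M"
        by (intro mult_left_mono) auto
      also have "\<dots> < \<delta>"
        using t M by (simp add: pos_less_divide_eq)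
      finally show "\<bar>line x y t i - x i\<bar> < \<delta>"
        by (simp add: line_def abs_mult)
    qed
  qed
qed

text \<open>
  The complement of a hypersurface is dense, in a form that also carries an open condition \<open>g > 0\<close>
  along.  Move from \<open>z\<close> towards a point where \<open>s\<close> is nonzero: \<open>g\<close> stays positive for a short time,
  and within that time \<open>s\<close> has only finitely many zeros on the line.
\<close>

lemma positive_and_nonvanishing_nearby:
  fixes g s :: "'a::linordered_field mpoly"
  assumes V: "openin (euclidean_top n) V" "z \<in> V" and g: "peval g z > 0"
    and s: "s \<in> polys n" "s \<noteq> 0"
  obtains y where "y \<in> V" "peval g y > 0" "peval s y \<noteq> 0"
proof -
  obtain w where w: "w \<in> affine_space n" "peval s w \<noteq> 0"
    using polys_nonvanishing_point s by blast
  obtain G S where G: "\<And>t. peval g (line z w t) = poly G t"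
    and S: "\<And>t. peval s (line z w t) = poly S t"
    using peval_line_poly[of g z w] peval_line_poly[of s z w] by blast
  obtain \<epsilon>1 where \<epsilon>1: "\<epsilon>1 > 0" "\<And>t. \<bar>t\<bar> < \<epsilon>1 \<Longrightarrow> poly G t > 0"
    using poly_pos_near_0[of G] G[of 0] g by auto
  obtain \<epsilon>2 where \<epsilon>2: "\<epsilon>2 > 0" "\<And>t. \<bar>t\<bar> < \<epsilon>2 \<Longrightarrow> line z w t \<in> V"
    using line_near_start V w(1) by blast
  have "S \<noteq> 0"
    using S[of 1] w by auto
  then have "finite {t. poly S t = 0}"
    by (rule poly_roots_finite)
  moreover have "infinite {0<..<min \<epsilon>1 \<epsilon>2}"
    using \<epsilon>1 \<epsilon>2 by (simp add: infinite_Ioo)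
  ultimately obtain t where "t \<in> {0<..<min \<epsilon>1 \<epsilon>2}" "poly S t \<noteq> 0"
    by (metis (mono_tags, lifting) finite_subset mem_Collect_eq subsetI)
  then show thesis
    using that[of "line z w t"] \<epsilon>1 \<epsilon>2 G S by auto
qed

text \<open>
  For \<open>B \<ge> 0\<close> the inequality \<open>\<bar>p\<bar> \<le> B * \<bar>q\<bar>\<close> fails exactly where the polynomial
  \<open>p\<^sup>2 - (B * q)\<^sup>2\<close> is positive, so a failure would spread to a point where \<open>s\<close> does not vanish.
\<close>

lemma polynomial_bound_extends:
  fixes p q s :: "'a::linordered_field mpoly"
  assumes V: "openin (euclidean_top n) V" and s: "s \<in> polys n" "s \<noteq> 0"
    and bound: "\<And>y. y \<in> V \<Longrightarrow> peval s y \<noteq> 0 \<Longrightarrow> \<bar>peval p y\<bar> \<le> B * \<bar>peval q y\<bar>"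
    and B: "B \<ge> 0" and z: "z \<in> V"
  shows "\<bar>peval p z\<bar> \<le> B * \<bar>peval q z\<bar>"
proof (rule ccontr)
  let ?g = "p\<^sup>2 - (Poly_Mapping.single 0 B * q)\<^sup>2"
  have eval: "peval ?g y = (peval p y)\<^sup>2 - (B * peval q y)\<^sup>2" for y
    by (simp add: peval_diff peval_power peval_mult peval_single monom_eval_def)
  have pos: "peval ?g y > 0 \<longleftrightarrow> \<not> \<bar>peval p y\<bar> \<le> B * \<bar>peval q y\<bar>" for y
    using B abs_le_square_iff[of "peval p y" "B * peval q y"]
    by (simp add: eval abs_mult not_le)
  assume "\<not> ?thesis"
  then have "peval ?g z > 0"
    using pos by blast
  then obtain y where "y \<in> V" "peval ?g y > 0" "peval s y \<noteq> 0"
    using positive_and_nonvanishing_nearby[OF V z _ s] by blast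
  then show False
    using bound pos by blast
qed

section \<open>Locally bounded rational functions\<close>

text \<open>
  Any presentation of \<open>f\<close> whose denominator is nonzero at \<open>x\<close> puts \<open>x\<close> into the domain, because the
  nonvanishing locus of a nonzero denominator is Zariski dense: it meets the nonvanishing locus of any
  other nonzero polynomial \<open>r\<close>, as \<open>q * r\<close> is again nonzero.
\<close>

lemma ratfun_dom_iff:
  fixes f :: "'a::field_char_0 ratfun"
  shows "x \<in> ratfun_dom n f \<longleftrightarrow> x \<in> affine_space n \<and>
    (\<exists>p\<in>polys n. \<exists>q\<in>polys n. q \<noteq> 0 \<and> f = Fract p q \<and> peval q x \<noteq> 0)" (is "?L \<longleftrightarrow> ?R")
proof
  assume ?L
  then show ?R
    unfolding ratfun_dom_def regular_on_def zariski_open_def by blast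
next
  assume ?R
  then obtain p q where x: "x \<in> affine_space n" and pq: "p \<in> polys n" "q \<in> polys n" "q \<noteq> 0"
    and f: "f = Fract p q" "peval q x \<noteq> 0"
    by blast
  let ?U = "affine_space n - {x. \<forall>r\<in>{q}. peval r x = 0}"
  have "zariski_open n ?U"
    unfolding zariski_open_def by (rule exI[of _ "{q}"]) (use pq in auto)
  moreover have "zariski_dense n ?U"
    unfolding zariski_dense_def
  proof (intro allI impI)
    fix W :: "(nat \<Rightarrow> 'a) set" assume "zariski_open n W \<and> W \<noteq> {}"
    then obtain P w where P: "P \<subseteq> polys n" "W = affine_space n - {x. \<forall>p\<in>P. peval p x = 0}" and "w \<in> W"
      unfolding zariski_open_def by blast
    then obtain r where r: "r \<in> P" "peval r w \<noteq> 0"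
      by blast
    then have "q * r \<in> polys n" "q * r \<noteq> 0"
      using pq P by auto
    then obtain y where "y \<in> affine_space n" "peval (q * r) y \<noteq> 0"
      by (rule polys_nonvanishing_point)
    then have "y \<in> ?U \<inter> W"
      using r P by (auto simp: peval_mult)
    then show "?U \<inter> W \<noteq> {}"
      by blast
  qed
  moreover have "regular_on n f ?U"
    unfolding regular_on_def using pq f by auto
  moreover have "x \<in> ?U"
    using x f by auto
  ultimately show ?L
    unfolding ratfun_dom_def by blast
qed

lemma peval_cross_eq:
  fixes p q p' q' :: "'a::field_char_0 mpoly"
  assumes "Fract p q = Fract p' q'" "q \<noteq> 0" "q' \<noteq> 0"
  shows "peval p x * peval q' x = peval p' x * peval q x"
  using assms by (metis eq_fract(1) peval_mult)

lemma ratfun_value_Fract: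
  fixes p q :: "'a::field_char_0 mpoly"
  assumes "p \<in> polys n" "q \<in> polys n" "peval q x \<noteq> 0"
  shows "ratfun_value n (Fract p q) x = peval p x / peval q x"
  unfolding ratfun_value_def
proof (rule the_equality)
  show "\<exists>p'\<in>polys n. \<exists>q'\<in>polys n. Fract p q = Fract p' q' \<and> peval q' x \<noteq> 0 \<and>
      peval p x / peval q x = peval p' x / peval q' x"
    using assms by blast
  fix v
  assume "\<exists>p'\<in>polys n. \<exists>q'\<in>polys n. Fract p q = Fract p' q' \<and> peval q' x \<noteq> 0 \<and>
      v = peval p' x / peval q' x"
  then obtain p' q' where eq: "Fract p q = Fract p' q'" and q': "peval q' x \<noteq> 0"
    and v: "v = peval p' x / peval q' x"
    by blast
  moreover have "q \<noteq> 0" "q' \<noteq> 0"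
    using assms(3) q' by auto
  ultimately show "v = peval p x / peval q x"
    using assms(3) peval_cross_eq[OF eq, of x] by (simp add: frac_eq_eq)
qed

text \<open>
  Near \<open>x\<close> and along \<open>D\<close> the quotient \<open>p / q\<close> is bounded by \<open>B\<close>, with the denominator cleared.  At
  zeros of \<open>q\<close> in \<open>V \<inter> D\<close> the condition forces \<open>p\<close> to vanish.  The region \<open>D\<close> is all of space for local
  boundedness, and a thin cusp when limits at the origin are compared.
\<close>

definition quotient_bound ::
  "nat \<Rightarrow> (nat \<Rightarrow> 'a) set \<Rightarrow> (nat \<Rightarrow> 'a) \<Rightarrow> 'a \<Rightarrow> 'a::linordered_field mpoly \<Rightarrow> 'a mpoly \<Rightarrow> bool" where
  "quotient_bound n D x B p q \<longleftrightarrow> (\<exists>V. openin (euclidean_top n) V \<and> x \<in> V \<and>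
     (\<forall>y \<in> V \<inter> D. \<bar>peval p y\<bar> \<le> B * \<bar>peval q y\<bar>))"

lemma quotient_bound_subset:
  "quotient_bound n D x B p q \<Longrightarrow> D' \<subseteq> D \<Longrightarrow> quotient_bound n D' x B p q"
  unfolding quotient_bound_def by blast

lemma quotient_bound_weaken:
  assumes "quotient_bound n D x B p q" "B \<le> B'"
  shows "quotient_bound n D x B' p q"
proof -
  have "B * \<bar>peval q y\<bar> \<le> B' * \<bar>peval q y\<bar>" for y
    using assms(2) by (intro mult_right_mono) auto
  then show ?thesis
    using assms(1) unfolding quotient_bound_def by (meson order_trans)
qed

lemma quotient_bound_trivial:
  assumes "x \<in> affine_space n" "\<And>y. \<bar>peval p y\<bar> \<le> B * \<bar>peval q y\<bar>"
  shows "quotient_bound n D x B p q"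
  unfolding quotient_bound_def
  by (rule exI[of _ "affine_space n"])
    (use assms openin_topspace[of "euclidean_top n :: (nat \<Rightarrow> 'a) topology"] in auto)

lemma quotient_bound_add:
  assumes "quotient_bound n D x B p q" "quotient_bound n D x B' p' q'"
  shows "quotient_bound n D x (B + B') (p * q' + p' * q) (q * q')"
proof -
  obtain V V' where V: "openin (euclidean_top n) V" "x \<in> V" "openin (euclidean_top n) V'" "x \<in> V'"
    "\<And>y. y \<in> V \<inter> D \<Longrightarrow> \<bar>peval p y\<bar> \<le> B * \<bar>peval q y\<bar>"
    "\<And>y. y \<in> V' \<inter> D \<Longrightarrow> \<bar>peval p' y\<bar> \<le> B' * \<bar>peval q' y\<bar>"
    using assms unfolding quotient_bound_def by blast
  have "\<bar>peval (p * q' + p' * q) y\<bar> \<le> (B + B') * \<bar>peval (q * q') y\<bar>" if "y \<in> (V \<inter> V') \<inter> D" for y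
  proof -
    have "\<bar>peval (p * q' + p' * q) y\<bar> \<le> \<bar>peval p y\<bar> * \<bar>peval q' y\<bar> + \<bar>peval p' y\<bar> * \<bar>peval q y\<bar>"
      unfolding peval_add peval_mult by (metis abs_mult abs_triangle_ineq)
    also have "\<dots> \<le> (B * \<bar>peval q y\<bar>) * \<bar>peval q' y\<bar> + (B' * \<bar>peval q' y\<bar>) * \<bar>peval q y\<bar>"
      using that V by (intro add_mono mult_right_mono) auto
    also have "\<dots> = (B + B') * \<bar>peval (q * q') y\<bar>"
      by (simp add: peval_mult abs_mult algebra_simps)
    finally show ?thesis .
  qed
  then show ?thesis
    unfolding quotient_bound_def using V by (intro exI[of _ "V \<inter> V'"]) auto
qed

lemma quotient_bound_mult:
  assumes "quotient_bound n D x B p q" "quotient_bound n D x B' p' q'"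
  shows "quotient_bound n D x (B * B') (p * p') (q * q')"
proof -
  obtain V V' where V: "openin (euclidean_top n) V" "x \<in> V" "openin (euclidean_top n) V'" "x \<in> V'"
    "\<And>y. y \<in> V \<inter> D \<Longrightarrow> \<bar>peval p y\<bar> \<le> B * \<bar>peval q y\<bar>"
    "\<And>y. y \<in> V' \<inter> D \<Longrightarrow> \<bar>peval p' y\<bar> \<le> B' * \<bar>peval q' y\<bar>"
    using assms unfolding quotient_bound_def by blast
  have "\<bar>peval (p * p') y\<bar> \<le> (B * B') * \<bar>peval (q * q') y\<bar>" if "y \<in> (V \<inter> V') \<inter> D" for y
  proof -
    have "\<bar>peval p y\<bar> \<le> B * \<bar>peval q y\<bar>" "\<bar>peval p' y\<bar> \<le> B' * \<bar>peval q' y\<bar>"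
      using that V by auto
    then have "\<bar>peval p y\<bar> * \<bar>peval p' y\<bar> \<le> (B * \<bar>peval q y\<bar>) * (B' * \<bar>peval q' y\<bar>)"
      by (intro mult_mono) (auto intro: order_trans[OF abs_ge_zero])
    then show ?thesis
      by (simp add: peval_mult abs_mult mult_ac)
  qed
  then show ?thesis
    unfolding quotient_bound_def using V by (intro exI[of _ "V \<inter> V'"]) auto
qed

lemma quotient_bound_uminus:
  "quotient_bound n D x B p q \<Longrightarrow> quotient_bound n D x B (- p) q"
  by (simp add: quotient_bound_def peval_uminus)

text \<open>
  The domain of a fraction may contain zeros of the chosen denominator \<open>q\<close>, where another presentation
  \<open>p' / q'\<close> computes the value.  In both directions the inequality is first obtained where \<open>q\<close> does not
  vanish and then extended by density.
\<close>

lemma locally_bounded_Fract: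
  fixes p q :: "'a::linordered_field mpoly"
  assumes p: "p \<in> polys n" and q: "q \<in> polys n" "q \<noteq> 0"
  shows "locally_bounded n (Fract p q) \<longleftrightarrow>
    (\<forall>x\<in>affine_space n. \<exists>B. quotient_bound n UNIV x B p q)" (is "?L \<longleftrightarrow> ?R")
proof
  assume L: ?L
  show ?R
  proof
    fix x :: "nat \<Rightarrow> 'a" assume "x \<in> affine_space n"
    with L obtain V B where V: "openin (euclidean_top n) V" "x \<in> V"
      and B: "\<And>y. y \<in> V \<inter> ratfun_dom n (Fract p q) \<Longrightarrow> \<bar>ratfun_value n (Fract p q) y\<bar> \<le> B"
      unfolding locally_bounded_def bounded_subset_def by (meson image_eqI)
    \<comment> \<open>Passing to \<open>max 0 B\<close> gives the sign condition of the density lemma without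
      showing first that \<open>V\<close> meets the domain.\<close>
    have "\<bar>peval p y\<bar> \<le> max 0 B * \<bar>peval q y\<bar>" if y: "y \<in> V" "peval q y \<noteq> 0" for y
    proof -
      have "y \<in> affine_space n"
        using y V openin_euclidean_subset by blast
      then have "y \<in> ratfun_dom n (Fract p q)"
        using y p q by (auto simp: ratfun_dom_iff)
      with B y have "\<bar>ratfun_value n (Fract p q) y\<bar> \<le> B"
        by blast
      then have "\<bar>peval p y / peval q y\<bar> \<le> B"
        using ratfun_value_Fract[OF p q(1) y(2)] by simp
      then have "\<bar>peval p y\<bar> \<le> B * \<bar>peval q y\<bar>"
        using y by (simp add: abs_divide pos_divide_le_eq)
      also have "\<dots> \<le> max 0 B * \<bar>peval q y\<bar>"
        by (intro mult_right_mono) auto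
      finally show ?thesis .
    qed
    then have "\<bar>peval p y\<bar> \<le> max 0 B * \<bar>peval q y\<bar>" if "y \<in> V" for y
      by (rule polynomial_bound_extends[OF V(1) q]) (use that in auto)
    then show "\<exists>B. quotient_bound n UNIV x B p q"
      unfolding quotient_bound_def using V by blast
  qed
next
  assume R: ?R
  show ?L
    unfolding locally_bounded_def
  proof
    fix x :: "nat \<Rightarrow> 'a" assume "x \<in> affine_space n"
    with R obtain B where "quotient_bound n UNIV x B p q"
      by blast
    then have "quotient_bound n UNIV x (max 0 B) p q"
      by (rule quotient_bound_weaken) simp
    then obtain V where V: "openin (euclidean_top n) V" "x \<in> V"
      and B: "\<And>y. y \<in> V \<Longrightarrow> \<bar>peval p y\<bar> \<le> max 0 B * \<bar>peval q y\<bar>"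
      unfolding quotient_bound_def by auto
    have "\<bar>ratfun_value n (Fract p q) y\<bar> \<le> max 0 B" if y: "y \<in> V \<inter> ratfun_dom n (Fract p q)" for y
    proof -
      obtain p' q' where p': "p' \<in> polys n" and q': "q' \<in> polys n" "q' \<noteq> 0"
        and eq: "Fract p q = Fract p' q'" and nz: "peval q' y \<noteq> 0"
        using y by (auto simp: ratfun_dom_iff)
      have bound: "\<bar>peval p' z\<bar> \<le> max 0 B * \<bar>peval q' z\<bar>" if z: "z \<in> V" "peval q z \<noteq> 0" for z
      proof -
        have "\<bar>peval p' z\<bar> * \<bar>peval q z\<bar> = \<bar>peval p z\<bar> * \<bar>peval q' z\<bar>"
          using peval_cross_eq[OF eq q(2) q'(2), of z] by (simp flip: abs_mult)
        also have "\<dots> \<le> (max 0 B * \<bar>peval q z\<bar>) * \<bar>peval q' z\<bar>"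
          using B z by (intro mult_right_mono) auto
        finally have "\<bar>peval p' z\<bar> * \<bar>peval q z\<bar> \<le> (max 0 B * \<bar>peval q' z\<bar>) * \<bar>peval q z\<bar>"
          by (simp add: mult_ac)
        then show ?thesis
          using z(2) by simp
      qed
      have "\<bar>peval p' y\<bar> \<le> max 0 B * \<bar>peval q' y\<bar>"
        by (rule polynomial_bound_extends[OF V(1) q bound]) (use y in auto)
      then show ?thesis
        using nz by (simp add: eq ratfun_value_Fract p' q' abs_divide pos_divide_le_eq)
    qed
    then show "\<exists>V. openin (euclidean_top n) V \<and> x \<in> V \<and>
        bounded_subset (ratfun_value n (Fract p q) ` (V \<inter> ratfun_dom n (Fract p q)))"
      unfolding bounded_subset_def using V by blast
  qed
qed

lemma carrier_Rb_cases:
  fixes f :: "'a::linordered_field ratfun"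
  assumes "f \<in> carrier (Rb n)"
  obtains p q where "f = Fract p q" "p \<in> polys n" "q \<in> polys n" "q \<noteq> 0"
    "\<forall>x\<in>affine_space n. \<exists>B. quotient_bound n UNIV x B p q"
proof -
  obtain p q where "f = Fract p q" "p \<in> polys n" "q \<in> polys n" "q \<noteq> 0" "locally_bounded n f"
    using assms unfolding Rb_def ratfuns_def by auto
  then show thesis
    using that locally_bounded_Fract by blast
qed

lemma Fract_in_Rb:
  fixes p q :: "'a::linordered_field mpoly"
  assumes "p \<in> polys n" "q \<in> polys n" "q \<noteq> 0"
    "\<And>x. x \<in> affine_space n \<Longrightarrow> \<exists>B. quotient_bound n UNIV x B p q"
  shows "Fract p q \<in> carrier (Rb n)"
  using assms locally_bounded_Fract[OF assms(1-3)] unfolding Rb_def ratfuns_def by auto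

lemma Rb_simps [simp]:
  "x \<otimes>\<^bsub>Rb n\<^esub> y = x * y" "x \<oplus>\<^bsub>Rb n\<^esub> y = x + y" "\<zero>\<^bsub>Rb n\<^esub> = 0" "\<one>\<^bsub>Rb n\<^esub> = 1"
  by (simp_all add: Rb_def)

lemma Rb_0: "(0 :: 'a::linordered_field ratfun) \<in> carrier (Rb n)"
  unfolding Zero_fract_def
  by (intro Fract_in_Rb exI[of _ 0] quotient_bound_trivial) auto

lemma Rb_1: "(1 :: 'a::linordered_field ratfun) \<in> carrier (Rb n)"
  unfolding One_fract_def
  by (intro Fract_in_Rb exI[of _ 1] quotient_bound_trivial) auto

lemma Rb_add:
  fixes f g :: "'a::linordered_field ratfun"
  assumes "f \<in> carrier (Rb n)" "g \<in> carrier (Rb n)"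
  shows "f + g \<in> carrier (Rb n)"
proof -
  obtain p q where f: "f = Fract p q" "p \<in> polys n" "q \<in> polys n" "q \<noteq> 0"
    "\<forall>x\<in>affine_space n. \<exists>B. quotient_bound n UNIV x B p q"
    using assms(1) by (rule carrier_Rb_cases)
  obtain p' q' where g: "g = Fract p' q'" "p' \<in> polys n" "q' \<in> polys n" "q' \<noteq> 0"
    "\<forall>x\<in>affine_space n. \<exists>B. quotient_bound n UNIV x B p' q'"
    using assms(2) by (rule carrier_Rb_cases)
  have "Fract (p * q' + p' * q) (q * q') \<in> carrier (Rb n)"
    using f g by (intro Fract_in_Rb) (auto dest!: bspec intro: quotient_bound_add)
  then show ?thesis
    by (simp add: f(1,4) g(1,4))
qed

lemma Rb_mult:
  fixes f g :: "'a::linordered_field ratfun"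
  assumes "f \<in> carrier (Rb n)" "g \<in> carrier (Rb n)"
  shows "f * g \<in> carrier (Rb n)"
proof -
  obtain p q where f: "f = Fract p q" "p \<in> polys n" "q \<in> polys n" "q \<noteq> 0"
    "\<forall>x\<in>affine_space n. \<exists>B. quotient_bound n UNIV x B p q"
    using assms(1) by (rule carrier_Rb_cases)
  obtain p' q' where g: "g = Fract p' q'" "p' \<in> polys n" "q' \<in> polys n" "q' \<noteq> 0"
    "\<forall>x\<in>affine_space n. \<exists>B. quotient_bound n UNIV x B p' q'"
    using assms(2) by (rule carrier_Rb_cases)
  have "Fract (p * p') (q * q') \<in> carrier (Rb n)"
    using f g by (intro Fract_in_Rb) (auto dest!: bspec intro: quotient_bound_mult)
  then show ?thesis
    by (simp add: f(1) g(1))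
qed

lemma Rb_uminus:
  fixes f :: "'a::linordered_field ratfun"
  assumes "f \<in> carrier (Rb n)"
  shows "- f \<in> carrier (Rb n)"
proof -
  obtain p q where f: "f = Fract p q" "p \<in> polys n" "q \<in> polys n" "q \<noteq> 0"
    "\<forall>x\<in>affine_space n. \<exists>B. quotient_bound n UNIV x B p q"
    using assms by (rule carrier_Rb_cases)
  then have "Fract (- p) q \<in> carrier (Rb n)"
    by (intro Fract_in_Rb) (auto dest!: bspec intro: quotient_bound_uminus)
  then show ?thesis
    by (simp add: f(1))
qed

lemma cring_Rb: "cring (Rb n :: 'a::linordered_field ratfun ring)"
proof (intro cringI abelian_groupI comm_monoidI)
  fix f :: "'a ratfun" assume "f \<in> carrier (Rb n)"
  then show "\<exists>g\<in>carrier (Rb n). g \<oplus>\<^bsub>Rb n\<^esub> f = \<zero>\<^bsub>Rb n\<^esub>"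
    by (intro bexI[of _ "- f"]) (auto intro: Rb_uminus)
qed (auto simp: Rb_0 Rb_1 Rb_add Rb_mult algebra_simps)

section \<open>An infinite strictly ascending chain of ideals\<close>

definition origin :: "nat \<Rightarrow> nat \<Rightarrow> 'a::zero" where
  "origin n = (\<lambda>i\<in>{..<n}. 0)"

lemma origin_in_affine_space [simp]: "origin n \<in> affine_space n"
  by (simp add: origin_def affine_space_def)

text \<open>
  The set \<open>\<bar>x 1\<bar> \<le> \<bar>x 0\<bar> ^ k\<close>, squared to make it polynomial.  Restricting to \<open>\<bar>x 0\<bar> \<le> 1\<close> makes the
  regions decrease with \<open>k\<close>.
\<close>

definition cusp_region :: "nat \<Rightarrow> (nat \<Rightarrow> 'a::linordered_field) set" where
  "cusp_region k = {x. \<bar>x 0\<bar> \<le> 1 \<and> (x 1)\<^sup>2 \<le> x 0 ^ (2 * k)}"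

text \<open>
  The functions that tend to \<open>0\<close> at the origin along \<open>D\<close>.  A single presentation with this property is
  asked for, rather than all of them: this makes the closure properties direct, and the one place where
  a different presentation has to be compared is \<open>cusp_fun_does_not_vanish\<close>.
\<close>

definition vanishing_ideal :: "nat \<Rightarrow> (nat \<Rightarrow> 'a) set \<Rightarrow> 'a::linordered_field ratfun set" where
  "vanishing_ideal n D = {f \<in> carrier (Rb n). \<exists>p\<in>polys n. \<exists>q\<in>polys n. q \<noteq> 0 \<and> f = Fract p q \<and>
     (\<forall>\<epsilon>>0. quotient_bound n D (origin n) \<epsilon> p q)}"

lemma vanishing_ideal_antimono: "D' \<subseteq> D \<Longrightarrow> vanishing_ideal n D \<subseteq> vanishing_ideal n D'"
  unfolding vanishing_ideal_def by (blast intro: quotient_bound_subset)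

lemma vanishing_ideal_add:
  assumes "f \<in> vanishing_ideal n D" "g \<in> vanishing_ideal n D"
  shows "f + g \<in> vanishing_ideal n D"
proof -
  obtain p q where f: "f \<in> carrier (Rb n)" "f = Fract p q" "p \<in> polys n" "q \<in> polys n" "q \<noteq> 0"
    "\<And>\<epsilon>. \<epsilon> > 0 \<Longrightarrow> quotient_bound n D (origin n) \<epsilon> p q"
    using assms(1) unfolding vanishing_ideal_def by blast
  obtain p' q' where g: "g \<in> carrier (Rb n)" "g = Fract p' q'" "p' \<in> polys n" "q' \<in> polys n" "q' \<noteq> 0"
    "\<And>\<epsilon>. \<epsilon> > 0 \<Longrightarrow> quotient_bound n D (origin n) \<epsilon> p' q'"
    using assms(2) unfolding vanishing_ideal_def by blast
  have "quotient_bound n D (origin n) \<epsilon> (p * q' + p' * q) (q * q')" if "\<epsilon> > 0" for \<epsilon>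
    using quotient_bound_add[OF f(6)[of "\<epsilon> / 2"] g(6)[of "\<epsilon> / 2"]] that by simp
  moreover have "f + g = Fract (p * q' + p' * q) (q * q')"
    by (simp add: f(2,5) g(2,5))
  moreover have "p * q' + p' * q \<in> polys n" "q * q' \<in> polys n" "q * q' \<noteq> 0"
    using f g by auto
  ultimately show ?thesis
    unfolding vanishing_ideal_def using Rb_add[OF f(1) g(1)] by blast
qed

text \<open>
  A function tending to \<open>0\<close> times a function bounded near the origin tends to \<open>0\<close>.
\<close>

lemma vanishing_ideal_mult:
  assumes "f \<in> vanishing_ideal n D" "g \<in> carrier (Rb n)"
  shows "f * g \<in> vanishing_ideal n D"
proof -
  obtain p q where f: "f \<in> carrier (Rb n)" "f = Fract p q" "p \<in> polys n" "q \<in> polys n" "q \<noteq> 0"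
    "\<And>\<epsilon>. \<epsilon> > 0 \<Longrightarrow> quotient_bound n D (origin n) \<epsilon> p q"
    using assms(1) unfolding vanishing_ideal_def by blast
  obtain p' q' where g: "g = Fract p' q'" "p' \<in> polys n" "q' \<in> polys n" "q' \<noteq> 0"
    "\<forall>x\<in>affine_space n. \<exists>B. quotient_bound n UNIV x B p' q'"
    using assms(2) by (rule carrier_Rb_cases)
  obtain B where "quotient_bound n UNIV (origin n) B p' q'"
    using g(5) origin_in_affine_space by blast
  then have "quotient_bound n D (origin n) B p' q'"
    by (rule quotient_bound_subset) simp
  then have B: "quotient_bound n D (origin n) (max 1 B) p' q'"
    by (rule quotient_bound_weaken) simp
  have "quotient_bound n D (origin n) \<epsilon> (p * p') (q * q')" if "\<epsilon> > 0" for \<epsilon>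
  proof -
    have "max 1 B > 0"
      by (simp add: less_max_iff_disj)
    with quotient_bound_mult[OF f(6)[of "\<epsilon> / max 1 B"] B] that show ?thesis
      by simp
  qed
  moreover have "f * g = Fract (p * p') (q * q')"
    by (simp add: f(2) g(1))
  moreover have "p * p' \<in> polys n" "q * q' \<in> polys n" "q * q' \<noteq> 0"
    using f g by auto
  ultimately show ?thesis
    unfolding vanishing_ideal_def using Rb_mult[OF f(1) assms(2)] by blast
qed

lemma vanishing_ideal_0: "0 \<in> vanishing_ideal n D"
proof -
  have "quotient_bound n D (origin n) \<epsilon> 0 1" if "\<epsilon> > 0" for \<epsilon>
    by (rule quotient_bound_trivial) (use that in auto)
  then have "\<forall>\<epsilon>>0. quotient_bound n D (origin n) \<epsilon> 0 1"
    by blast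
  then show ?thesis
    unfolding vanishing_ideal_def mem_Collect_eq
    by (intro conjI Rb_0 bexI[of _ 0] bexI[of _ 1]) (simp_all add: Zero_fract_def)
qed

lemma ideal_vanishing_ideal: "ideal (vanishing_ideal n D) (Rb n)"
proof -
  interpret R: cring "Rb n :: 'a ratfun ring"
    by (rule cring_Rb)
  have neg: "\<ominus>\<^bsub>Rb n\<^esub> f = - f" if "f \<in> carrier (Rb n)" for f :: "'a ratfun"
    using that by (intro R.minus_equality) (auto intro: Rb_uminus)
  have sub: "vanishing_ideal n D \<subseteq> carrier (Rb n)"
    unfolding vanishing_ideal_def by blast
  show ?thesis
  proof (rule idealI[OF R.ring_axioms])
    show "subgroup (vanishing_ideal n D) (add_monoid (Rb n))"
    proof (rule R.add.subgroupI)
      fix f assume f: "f \<in> vanishing_ideal n D"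
      then have "f * - 1 \<in> vanishing_ideal n D"
        by (rule vanishing_ideal_mult) (rule Rb_uminus[OF Rb_1])
      with f sub show "\<ominus>\<^bsub>Rb n\<^esub> f \<in> vanishing_ideal n D"
        by (auto simp: neg)
    qed (use sub vanishing_ideal_0 in \<open>auto intro: vanishing_ideal_add\<close>)
  qed (auto intro: vanishing_ideal_mult simp: mult.commute)
qed

definition cusp_num :: "'a::comm_semiring_1 mpoly" where
  "cusp_num = (var 1)\<^sup>2"

definition cusp_den :: "nat \<Rightarrow> 'a::comm_semiring_1 mpoly" where
  "cusp_den k = var 0 ^ (2 * k) + (var 1)\<^sup>2"

lemma peval_cusp_num: "peval cusp_num x = (x 1)\<^sup>2"
  by (simp add: cusp_num_def peval_power)

lemma peval_cusp_den: "peval (cusp_den k) x = x 0 ^ (2 * k) + (x 1)\<^sup>2"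
  by (simp add: cusp_den_def peval_power peval_add)

lemma cusp_den_nonzero: "cusp_den k \<noteq> (0 :: 'a::linordered_field mpoly)"
proof
  assume "cusp_den k = (0 :: 'a mpoly)"
  then have "peval (cusp_den k) (\<lambda>_. 1 :: 'a) = 0"
    by simp
  then show False
    by (simp add: peval_cusp_den)
qed

lemma cusp_polys:
  assumes "n \<ge> 2"
  shows "cusp_num \<in> polys n" "cusp_den k \<in> polys n"
  using assms unfolding cusp_num_def cusp_den_def by (intro conjI polys_add polys_power polys_var; simp)+

lemma cusp_fun_in_Rb:
  assumes "n \<ge> 2"
  shows "(Fract cusp_num (cusp_den k) :: 'a::linordered_field ratfun) \<in> carrier (Rb n)"
proof (intro Fract_in_Rb exI[of _ 1] quotient_bound_trivial)
  fix y :: "nat \<Rightarrow> 'a"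
  show "\<bar>peval cusp_num y\<bar> \<le> 1 * \<bar>peval (cusp_den k) y\<bar>"
    using zero_le_even_power'[of "y 0" k] by (simp add: peval_cusp_num peval_cusp_den)
qed (use assms in \<open>auto simp: cusp_polys cusp_den_nonzero\<close>)

text \<open>
  On the region of index \<open>k + 1\<close> the numerator is at most \<open>x\<^sup>2 * x\<^bsup>2k\<^esup>\<close>, hence at most \<open>x\<^sup>2\<close>
  times the denominator.
\<close>

lemma cusp_fun_vanishes:
  assumes "n \<ge> 2"
  shows "(Fract cusp_num (cusp_den k) :: 'a::linordered_field ratfun)
    \<in> vanishing_ideal n (cusp_region (Suc k))"
proof -
  have "quotient_bound n (cusp_region (Suc k)) (origin n) \<epsilon> cusp_num (cusp_den k)"
    if \<epsilon>: "\<epsilon> > 0" for \<epsilon> :: 'a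
  proof -
    let ?V = "{x \<in> affine_space n. \<bar>x 0 - 0\<bar> < min 1 \<epsilon>}"
    have "\<bar>peval cusp_num y\<bar> \<le> \<epsilon> * \<bar>peval (cusp_den k) y\<bar>" if y: "y \<in> ?V \<inter> cusp_region (Suc k)" for y
    proof -
      have "(y 0)\<^sup>2 = \<bar>y 0\<bar> * \<bar>y 0\<bar>"
        by (simp add: power2_eq_square)
      also have "\<dots> \<le> 1 * \<epsilon>"
        using y by (intro mult_mono) auto
      finally have "(y 0)\<^sup>2 \<le> \<epsilon>"
        by simp
      then have "(y 0)\<^sup>2 * y 0 ^ (2 * k) \<le> \<epsilon> * y 0 ^ (2 * k)"
        using zero_le_even_power' by (intro mult_right_mono) auto
      moreover have "(y 1)\<^sup>2 \<le> (y 0)\<^sup>2 * y 0 ^ (2 * k)"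
        using y by (simp add: cusp_region_def power_add[symmetric])
      moreover have "0 \<le> \<epsilon> * (y 1)\<^sup>2"
        using \<epsilon> by simp
      ultimately have "(y 1)\<^sup>2 \<le> \<epsilon> * (y 0 ^ (2 * k) + (y 1)\<^sup>2)"
        by (simp add: distrib_left)
      then show ?thesis
        using zero_le_even_power'[of "y 0" k] by (simp add: peval_cusp_num peval_cusp_den)
    qed
    moreover have "openin (euclidean_top n) ?V"
      using assms by (intro openin_slab) auto
    moreover have "origin n \<in> ?V"
      using assms \<epsilon> by (auto simp: origin_def affine_space_def)
    ultimately show ?thesis
      unfolding quotient_bound_def by blast
  qed
  then show ?thesis
    unfolding vanishing_ideal_def
    using assms cusp_fun_in_Rb cusp_polys cusp_den_nonzero by blast
qed

text \<open>
  Where \<open>x\<^bsup>k\<^esup> / 2 < \<bar>y\<bar> < x\<^bsup>k\<^esup>\<close> for \<open>x > 0\<close>, the function exceeds \<open>1 / 8\<close>, and this set accumulates at the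
  origin along \<open>y = 3 / 4 * x\<^bsup>k\<^esup>\<close> because \<open>k \<ge> 1\<close>.  The given presentation \<open>p / q\<close> may be \<open>0 / 0\<close> all along
  this curve, so the density lemma is used to move to a point of the set with \<open>q \<noteq> 0\<close>.
\<close>

lemma cusp_fun_does_not_vanish:
  assumes n: "n \<ge> 2" and k: "k \<ge> 1"
  shows "(Fract cusp_num (cusp_den k) :: 'a::linordered_field ratfun)
    \<notin> vanishing_ideal n (cusp_region k)"
proof
  assume "(Fract cusp_num (cusp_den k) :: 'a ratfun) \<in> vanishing_ideal n (cusp_region k)"
  then obtain p q :: "'a mpoly" where p: "p \<in> polys n" and q: "q \<in> polys n" "q \<noteq> 0"
    and eq: "Fract cusp_num (cusp_den k) = Fract p q"
    and "\<forall>\<epsilon>>0. quotient_bound n (cusp_region k) (origin n) \<epsilon> p q"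
    unfolding vanishing_ideal_def by blast
  then have "quotient_bound n (cusp_region k) (origin n) (1 / 8) p q"
    by simp
  then obtain V where V: "openin (euclidean_top n) V" "origin n \<in> V"
    and small: "\<And>y. y \<in> V \<inter> cusp_region k \<Longrightarrow> \<bar>peval p y\<bar> \<le> 1 / 8 * \<bar>peval q y\<bar>"
    unfolding quotient_bound_def by blast
  obtain \<delta> where \<delta>: "\<delta> > 0"
    "\<And>y. y \<in> affine_space n \<Longrightarrow> (\<And>i. i < n \<Longrightarrow> \<bar>y i - origin n i\<bar> < \<delta>) \<Longrightarrow> y \<in> V"
    using euclidean_top_contains_box[OF V] by blast
  define t where "t = min (1 / 2) (\<delta> / 2)"
  have t: "0 < t" "t < 1" "t < \<delta>"
    using \<delta>(1) by (auto simp: t_def min_less_iff_disj)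
  define z where "z = (\<lambda>i\<in>{..<n}. if i = 0 then t else if i = 1 then 3 / 4 * t ^ k else 0)"
  have z01: "z 0 = t" "z 1 = 3 / 4 * t ^ k"
    using n by (auto simp: z_def)
  have zV: "z \<in> V"
  proof (rule \<delta>(2))
    show "z \<in> affine_space n"
      by (simp add: z_def affine_space_def)
    fix i assume "i < n"
    have "t ^ k \<le> t ^ 1"
      using t k by (intro power_decreasing) auto
    then have "3 / 4 * t ^ k \<le> 3 / 4 * t"
      by simp
    also have "\<dots> < \<delta>"
      using t by simp
    finally show "\<bar>z i - origin n i\<bar> < \<delta>"
      using \<open>i < n\<close> t by (auto simp: z_def origin_def abs_mult)
  qed
  \<comment> \<open>The nearby point must keep \<open>\<bar>x 0\<bar> \<le> 1\<close> in order to lie in the cusp region.\<close>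
  let ?W = "V \<inter> {x \<in> affine_space n. \<bar>x 0 - 0\<bar> < 1}"
  have W: "openin (euclidean_top n) ?W"
    using n by (intro openin_Int V(1) openin_slab) auto
  have zW: "z \<in> ?W"
    using zV V(1) openin_euclidean_subset t by (auto simp: z01)
  \<comment> \<open>The two factors cannot both be negative, so positivity of \<open>?g\<close> encodes both inequalities
    \<open>(x 1)\<^sup>2 < x 0 ^ (2 * k) < 4 * (x 1)\<^sup>2\<close> in a single polynomial.\<close>
  let ?g = "(var 0 ^ (2 * k) - (var 1)\<^sup>2) * (4 * (var 1)\<^sup>2 - var 0 ^ (2 * k)) :: 'a mpoly"
  have four: "peval (4 :: 'a mpoly) y = 4" for y
    using peval_single[of 0 "4 :: 'a" y] by (simp add: monom_eval_def)
  have g: "peval ?g y = (y 0 ^ (2 * k) - (y 1)\<^sup>2) * (4 * (y 1)\<^sup>2 - y 0 ^ (2 * k))" for y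
    by (simp add: peval_mult peval_diff peval_power four)
  have "(z 1)\<^sup>2 = 9 / 16 * z 0 ^ (2 * k)"
    unfolding z01 by (simp add: power_mult_distrib power_mult[symmetric] power_divide mult.commute[of k])
  moreover have "z 0 ^ (2 * k) > 0"
    using t by (simp add: z01)
  ultimately have "peval ?g z > 0"
    unfolding g by simp
  then obtain y where y: "y \<in> ?W" "peval ?g y > 0" "peval q y \<noteq> 0"
    using positive_and_nonvanishing_nearby[OF W zW _ q] by blast
  have "0 \<le> y 0 ^ (2 * k)" "0 \<le> (y 1)\<^sup>2"
    by (auto simp: zero_le_even_power')
  then have between: "(y 1)\<^sup>2 < y 0 ^ (2 * k)" "y 0 ^ (2 * k) < 4 * (y 1)\<^sup>2"
    using y(2) unfolding g zero_less_mult_iff by linarith+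
  let ?a = "(y 1)\<^sup>2" and ?b = "y 0 ^ (2 * k)"
  have "?a * peval q y = peval p y * (?b + ?a)"
    using peval_cross_eq[OF eq cusp_den_nonzero q(2), of y]
    by (simp add: peval_cusp_num peval_cusp_den)
  then have "?a * \<bar>peval q y\<bar> = \<bar>peval p y\<bar> * (?b + ?a)"
    using between by (metis abs_mult abs_of_nonneg add_nonneg_nonneg zero_le_even_power' zero_le_power2)
  also have "\<dots> \<le> (1 / 8 * \<bar>peval q y\<bar>) * (?b + ?a)"
    using small[of y] y(1) between by (intro mult_right_mono) (auto simp: cusp_region_def)
  also have "\<dots> = \<bar>peval q y\<bar> * ((?b + ?a) / 8)"
    by simp
  finally have "?a \<le> (?b + ?a) / 8"
    using y(3) by (simp add: mult.commute)
  with between show False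
    by simp
qed

lemma cusp_region_antimono:
  assumes "j \<le> k"
  shows "cusp_region k \<subseteq> (cusp_region j :: (nat \<Rightarrow> 'a::linordered_field) set)"
proof
  fix x :: "nat \<Rightarrow> 'a" assume x: "x \<in> cusp_region k"
  then have "(x 0)\<^sup>2 \<le> 1"
    by (simp add: cusp_region_def abs_square_le_1)
  then have "((x 0)\<^sup>2) ^ k \<le> ((x 0)\<^sup>2) ^ j"
    using assms by (intro power_decreasing) auto
  with x show "x \<in> cusp_region j"
    by (simp add: cusp_region_def power_mult)
qed

text \<open>
  In a Noetherian ring the union of a nonempty chain of ideals belongs to the chain; here that would be a
  largest member of the sequence \<open>J\<close>.
\<close>

lemma not_noetherian_if_strict_chain:
  assumes "\<And>k :: nat. ideal (J k) R" "mono J" "\<And>k. J k \<noteq> J (Suc k)"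
  shows "\<not> noetherian_ring R"
proof
  assume "noetherian_ring R"
  moreover have "subset.chain {I. ideal I R} (range J)"
  proof -
    have "J i \<subseteq> J j \<or> J j \<subseteq> J i" for i j
      using assms(2) by (meson monoD nat_le_linear)
    then show ?thesis
      using assms(1) by (auto simp: subset.chain_def)
  qed
  ultimately obtain m where "\<Union>(range J) = J m"
    using noetherian_ring.ideal_chain_is_trivial by blast
  then have "J (Suc m) \<subseteq> J m"
    by blast
  with assms(2,3) show False
    by (metis lessI less_imp_le monoD subset_antisym)
qed

theorem proposition3p20:
  fixes n :: nat
  assumes "n \<ge> 2"
  shows "cring (Rb n :: 'a::real_closed_field ratfun ring) \<and>
         \<not> noetherian_ring (Rb n :: 'a ratfun ring)"
proof
  let ?J = "\<lambda>k. vanishing_ideal n (cusp_region (Suc k)) :: 'a ratfun set"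
  show "cring (Rb n :: 'a ratfun ring)"
    by (rule cring_Rb)
  show "\<not> noetherian_ring (Rb n :: 'a ratfun ring)"
  proof (rule not_noetherian_if_strict_chain)
    show "ideal (?J k) (Rb n)" for k
      by (rule ideal_vanishing_ideal)
    show "mono ?J"
      by (intro monoI vanishing_ideal_antimono cusp_region_antimono) simp
    \<comment> \<open>The exponents start at \<open>1\<close>: for exponent \<open>0\<close> the curve \<open>y = 3 / 4 * x\<^bsup>k\<^esup>\<close> misses the origin.\<close>
    show "?J k \<noteq> ?J (Suc k)" for k
      using cusp_fun_vanishes[OF assms, of "Suc k"]
        cusp_fun_does_not_vanish[OF assms, of "Suc k"] by auto
  qed
qed

end
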